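(* Let $i\ge 1$ and $L\ge 1$ be integers, let $a_1,\dots,a_i$ be non-negative integers with $a_i\ge a_j$ for all $j\in[i]$, and let $K=1+(i-1)L+\sum_{j=1}^{i}a_j$. Let $R_u=\min\{2(K-(i-1)L)+i-2-a_i,\;K\}$ and let $R^*$ be the optimal transmission rate of the $\overline{(a_i,a_{i-1},\dots,a_1)}_L$-ICP (which has $K$ users). Then $$\frac{R_u}{R^*}\le 2.$$
   Context: Notation: $[n]=\{1,\dots,n\}$; $\langle m\rangle_n$ is the unique element of $[n]$ congruent to $m$ modulo $n$. Index coding problem (ICP): a server holds a finite collection of files, each of size 1 unit ($F$ bits, $F$ sufficiently large), mutually unrelated (arbitrary $F$-bit strings). There are $K$ users; user $k$ wants the set of files $\mathcal W_k$ and knows the set of files $\mathcal K_k$ (side-information), with $\mathcal K_k\cap\mathcal W_k=\emptyset$. The server broadcasts one message (a function of all the files) such that every user $k$ can recover all files in $\mathcal W_k$ from the message and the files in $\mathcal K_k$. The optimal transmission rate $R^*$ is the minimum (infimum) message size, in units of the file size, over all coding strategies (and $F$ large). The $\overline{(a_i,a_{i-1},\dots,a_1)}_L$-ICP: for non-negative integers $a_1,\dots,a_i$ and a positive integer $L$, put $K=1+(i-1)L+\sum_{j=1}^i a_j$. There are $K$ users and $iK$ files $x_{k,t}$, $k\in[K]$, $t\in[i]$. User $k\in[K]$ wants $\mathcal W_k=\{x_{k,1},\dots,x_{k,i}\}$ and knows $$\mathcal K_k=\Big\{x_{b,t}: t\in[i],\,v\in[i-1],\,r\in[L],\ b=\Big\langle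 k+\sum_{j=1}^{v}a_{\langle i+t-j\rangle_i}+(v-1)L+r\Big\rangle_K\Big\}.$$ (That is, for each fixed $t$, going cyclically from $x_{k,t}$ one sees $a_{\langle t-1\rangle_i}$ unknown files, $L$ known files, $a_{\langle t-2\rangle_i}$ unknown files, $L$ known files, and so on, ending with $a_t$ unknown files.) *)

theory Defs
  imports "HOL-Analysis.Analysis"
begin

record ('u, 'f) icp =
  users :: "'u set"
  files :: "'f set"
  wants :: "'u \<Rightarrow> 'f set"
  knows :: "'u \<Rightarrow> 'f set"

definition wf_icp :: "('u, 'f) icp \<Rightarrow> bool" where
  "wf_icp P \<longleftrightarrow> finite (users P) \<and> finite (files P) \<and>
     (\<forall>u\<in>users P. wants P u \<subseteq> files P \<and> knows P u \<subseteq> files P \<and> knows P u \<inter> wants P u = {})"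

text \<open>
  The contents of the files are arbitrary bit strings of a common length \<open>F\<close>. Realizations are
  extensional functions on the file set, so an encoder sees the files of the problem only, and a
  decoder sees the message and the restriction of the realization to the side information.
\<close>

definition realizations :: "('u, 'f) icp \<Rightarrow> nat \<Rightarrow> ('f \<Rightarrow> bool list) set" where
  "realizations P F = (\<Pi>\<^sub>E f\<in>files P. {w. length w = F})"

definition index_code ::
  "('u, 'f) icp \<Rightarrow> nat \<Rightarrow> nat \<Rightarrow> (('f \<Rightarrow> bool list) \<Rightarrow> bool list) \<Rightarrow>
     ('u \<Rightarrow> bool list \<Rightarrow> ('f \<Rightarrow> bool list) \<Rightarrow> 'f \<Rightarrow> bool list) \<Rightarrow> bool" where
  "index_code P F l enc dec \<longleftrightarrow>
     (\<forall>X\<in>realizations P F. length (enc X) = l \<and>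
        (\<forall>u\<in>users P. \<forall>f\<in>wants P u. dec u (enc X) (restrict X (knows P u)) f = X f))"

text \<open>
  The infimum ranges over all file sizes \<open>F \<ge> 1\<close>. Restricting it to \<open>F\<close> beyond
  any bound would give the same value: by \<open>index_code_repeat\<close> below, repeating a code
  preserves its rate.
\<close>

definition optimal_rate :: "('u, 'f) icp \<Rightarrow> real" where
  "optimal_rate P =
     Inf {real l / real F | F l. F \<ge> 1 \<and> (\<exists>enc dec. index_code P F l enc dec)}"

text \<open>The element of \<open>{1..n}\<close> congruent to \<open>m\<close> modulo \<open>n\<close>, for \<open>n \<ge> 1\<close>.\<close>

definition cyc :: "nat \<Rightarrow> nat \<Rightarrow> nat" where
  "cyc n m = (THE r. r \<in> {1..n} \<and> r mod n = m mod n)"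

definition num_users :: "nat \<Rightarrow> nat \<Rightarrow> (nat \<Rightarrow> nat) \<Rightarrow> nat" where
  "num_users i L a = 1 + (i - 1) * L + (\<Sum>j=1..i. a j)"

text \<open>
  The pair \<open>(k, t)\<close> stands for the file \<open>x\<^sub>k\<^sub>,\<^sub>t\<close>. Only the values \<open>a 1, \<dots>, a i\<close> matter, and no
  subtraction below truncates when \<open>i \<ge> 1\<close>, since \<open>1 \<le> j \<le> v \<le> i - 1\<close>.
\<close>

definition consecutive_icp :: "nat \<Rightarrow> nat \<Rightarrow> (nat \<Rightarrow> nat) \<Rightarrow> (nat, nat \<times> nat) icp" where
  "consecutive_icp i L a = (let K = num_users i L a in
     \<lparr> users = {1..K},
       files = {1..K} \<times> {1..i},
       wants = (\<lambda>k. {(k, t) | t. t \<in> {1..i}}),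
       knows = (\<lambda>k. {(b, t) | b t v r. t \<in> {1..i} \<and> v \<in> {1..i - 1} \<and> r \<in> {1..L} \<and>
                      b = cyc K (k + (\<Sum>j=1..v. a (cyc i (i + t - j))) + (v - 1) * L + r)}) \<rparr>)"


lemma cyc_unique:
  fixes n m :: nat
  assumes "n \<ge> 1"
  shows "\<exists>!r. r \<in> {1..n} \<and> r mod n = m mod n"
proof (rule ex_ex1I)
  show "\<exists>r. r \<in> {1..n} \<and> r mod n = m mod n"
  proof (cases "m mod n = 0")
    case True
    then show ?thesis using assms by (intro exI[of _ n]) auto
  next
    case False
    then show ?thesis using assms
      by (intro exI[of _ "m mod n"]) (auto simp: less_imp_le)
  qed
next
  fix r s
  assume "r \<in> {1..n} \<and> r mod n = m mod n" "s \<in> {1..n} \<and> s mod n = m mod n"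
  then show "r = s"
    by (metis atLeastAtMost_iff le_neq_implies_less mod_less mod_self not_one_le_zero)
qed

lemma cyc_props:
  assumes "n \<ge> 1"
  shows "cyc n m \<in> {1..n}" "cyc n m mod n = m mod n"
  using theI'[OF cyc_unique[OF assms, of m]] by (auto simp: cyc_def)

lemma cyc_offset_sum:
  assumes t: "t \<in> {1..i}" and v: "v \<in> {1..i - 1}"
  shows "(\<Sum>j=1..v. a (cyc i (i + t - j))) \<le> (\<Sum>j=1..i. (a j :: nat))"
proof -
  have i: "i \<ge> 1" using t by auto
  have inj: "inj_on (\<lambda>j. cyc i (i + t - j)) {1..v}"
  proof (rule inj_onI)
    fix x y assume x: "x \<in> {1..v}" and y: "y \<in> {1..v}"
      and eq: "cyc i (i + t - x) = cyc i (i + t - y)"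
    have m: "(i + t - x) mod i = (i + t - y) mod i"
      using cyc_props(2)[OF i] eq by metis
    have "int i dvd int (i + t - x) - int (i + t - y)"
      using m by (metis mod_eq_dvd_iff zmod_int)
    moreover have "int (i + t - x) - int (i + t - y) = int y - int x"
      using x y v t by auto
    ultimately have d: "int i dvd int y - int x" by simp
    show "x = y"
    proof (rule ccontr)
      assume "x \<noteq> y"
      then have "int i \<le> \<bar>int y - int x\<bar>"
        using d by (intro zdvd_imp_le) auto
      then show False using x y v by auto
    qed
  qed
  have "(\<Sum>j=1..v. a (cyc i (i + t - j))) = sum a ((\<lambda>j. cyc i (i + t - j)) ` {1..v})"
    using inj by (simp add: sum.reindex)
  also have "\<dots> \<le> (\<Sum>j=1..i. a j)"
    using cyc_props(1)[OF i] by (intro sum_mono2) auto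
  finally show ?thesis .
qed

lemma wf_consecutive_icp: "wf_icp (consecutive_icp i L a)"
proof -
  define K where "K = num_users i L a"
  have K: "K \<ge> 1" by (simp add: K_def num_users_def)
  have ne: "cyc K (k + (\<Sum>j=1..v. a (cyc i (i + t - j))) + (v - 1) * L + r) \<noteq> k"
    if k: "k \<in> {1..K}" and t: "t \<in> {1..i}" and v: "v \<in> {1..i - 1}" and r: "r \<in> {1..L}"
    for k t v r
  proof
    define d where "d = (\<Sum>j=1..v. a (cyc i (i + t - j))) + (v - 1) * L + r"
    assume "cyc K (k + (\<Sum>j=1..v. a (cyc i (i + t - j))) + (v - 1) * L + r) = k"
    then have "(k + d) mod K = k mod K"
      using cyc_props(2)[OF K, of "k + d"] by (simp add: d_def add.assoc)
    then have "K dvd d"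
      by (metis add_diff_cancel_left' le_add1 mod_eq_dvd_iff_nat)
    moreover have "d \<ge> 1" using r by (auto simp: d_def)
    ultimately have "K \<le> d" by (intro dvd_imp_le) auto
    have "(v - 1) * L + r \<le> (v - 1) * L + L" using r by auto
    also have "\<dots> = v * L" using v by (cases v) auto
    also have "\<dots> \<le> (i - 1) * L" using v by (intro mult_right_mono) auto
    finally have "d < K"
      using cyc_offset_sum[OF t v, of a] by (auto simp: d_def K_def num_users_def)
    with \<open>K \<le> d\<close> show False by simp
  qed
  show ?thesis
    unfolding wf_icp_def consecutive_icp_def Let_def K_def[symmetric] icp.simps
  proof (intro conjI ballI)
    fix k assume k: "k \<in> {1..K}"
    show "{(b, t) | b t v r. t \<in> {1..i} \<and> v \<in> {1..i - 1} \<and> r \<in> {1..L} \<and>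
            b = cyc K (k + (\<Sum>j=1..v. a (cyc i (i + t - j))) + (v - 1) * L + r)}
          \<subseteq> {1..K} \<times> {1..i}"
      using cyc_props(1)[OF K] by blast
    show "{(b, t) | b t v r. t \<in> {1..i} \<and> v \<in> {1..i - 1} \<and> r \<in> {1..L} \<and>
            b = cyc K (k + (\<Sum>j=1..v. a (cyc i (i + t - j))) + (v - 1) * L + r)}
          \<inter> {(k, t) | t. t \<in> {1..i}} = {}"
    proof (rule ccontr)
      assume "\<not> ?thesis"
      then obtain t v r where "t \<in> {1..i}" "v \<in> {1..i - 1}" "r \<in> {1..L}"
        "k = cyc K (k + (\<Sum>j=1..v. a (cyc i (i + t - j))) + (v - 1) * L + r)"
        by blast
      with ne[OF k, of t v r] show False by metis
    qed
  qed auto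
qed

lemma index_code_append:
  assumes wf: "wf_icp P"
    and c1: "index_code P F1 l1 enc1 dec1" and c2: "index_code P F2 l2 enc2 dec2"
  shows "\<exists>enc dec. index_code P (F1 + F2) (l1 + l2) enc dec"
proof -
  define A where "A = (\<lambda>S X. restrict (\<lambda>f. take F1 (X f :: bool list)) (S :: 'b set))"
  define B where "B = (\<lambda>S X. restrict (\<lambda>f. drop F1 (X f :: bool list)) (S :: 'b set))"
  define enc where "enc = (\<lambda>X. enc1 (A (files P) X) @ enc2 (B (files P) X))"
  define dec where "dec = (\<lambda>u m Y f. dec1 u (take l1 m) (A (knows P u) Y) f
                                   @ dec2 u (drop l1 m) (B (knows P u) Y) f)"
  have "index_code P (F1 + F2) (l1 + l2) enc dec"
    unfolding index_code_def
  proof (intro ballI conjI)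
    fix X assume X: "X \<in> realizations P (F1 + F2)"
    have XA: "A (files P) X \<in> realizations P F1" and XB: "B (files P) X \<in> realizations P F2"
      using X by (auto simp: realizations_def A_def B_def PiE_iff)
    have l1: "length (enc1 (A (files P) X)) = l1" and l2: "length (enc2 (B (files P) X)) = l2"
      using c1 c2 XA XB by (auto simp: index_code_def)
    show "length (enc X) = l1 + l2" using l1 l2 by (simp add: enc_def)
    fix u f assume u: "u \<in> users P" and f: "f \<in> wants P u"
    have sub: "knows P u \<subseteq> files P" and ff: "f \<in> files P"
      using wf u f by (auto simp: wf_icp_def)
    have rA: "A (knows P u) (restrict X (knows P u)) = restrict (A (files P) X) (knows P u)"
      and rB: "B (knows P u) (restrict X (knows P u)) = restrict (B (files P) X) (knows P u)"
      using sub by (auto simp: A_def B_def restrict_def fun_eq_iff)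
    have "dec u (enc X) (restrict X (knows P u)) f = A (files P) X f @ B (files P) X f"
      using c1 c2 XA XB u f l1 by (simp add: dec_def enc_def rA rB index_code_def)
    also have "\<dots> = X f" using ff by (simp add: A_def B_def)
    finally show "dec u (enc X) (restrict X (knows P u)) f = X f" .
  qed
  then show ?thesis by blast
qed

lemma index_code_repeat:
  assumes wf: "wf_icp P" and c: "index_code P F l enc dec" and n: "n \<ge> 1"
  shows "\<exists>enc' dec'. index_code P (n * F) (n * l) enc' dec'"
  using n
proof (induction n rule: dec_induct)
  case base
  then show ?case using c by auto
next
  case (step n)
  then obtain enc' dec' where "index_code P (n * F) (n * l) enc' dec'" by blast
  from index_code_append[OF wf c this] show ?case by simp
qed

lemma index_code_exists:
  assumes "wf_icp P"
  shows "\<exists>l enc dec. index_code P 1 l enc dec"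
proof -
  obtain fs where fs: "set fs = files P"
    using assms finite_list[of "files P"] by (auto simp: wf_icp_def)
  define enc where "enc = (\<lambda>X. concat (map (X :: 'b \<Rightarrow> bool list) fs))"
  define dec where "dec = (\<lambda>(u :: 'a) m (Y :: 'b \<Rightarrow> bool list) f.
    inv_into (realizations P 1) enc m f)"
  have len: "length (enc X) = length fs" if "X \<in> realizations P 1" for X
  proof -
    have "length (concat (map X gs)) = length gs" if "set gs \<subseteq> files P" for gs
      using that \<open>X \<in> realizations P 1\<close>
      by (induction gs) (auto simp: realizations_def PiE_iff)
    then show ?thesis using fs by (simp add: enc_def)
  qed
  have inj: "inj_on enc (realizations P 1)"
  proof (rule inj_onI)
    fix X Y assume X: "X \<in> realizations P 1" and Y: "Y \<in> realizations P 1"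
      and eq: "enc X = enc Y"
    have "\<forall>f\<in>set gs. X f = Y f"
      if "set gs \<subseteq> files P" "concat (map X gs) = concat (map Y gs)" for gs
      using that
    proof (induction gs)
      case (Cons g gs)
      then have "length (X g) = length (Y g)"
        using X Y by (auto simp: realizations_def PiE_iff)
      with Cons show ?case by auto
    qed auto
    then have "\<forall>f\<in>files P. X f = Y f" using fs eq by (auto simp: enc_def)
    then show "X = Y" using X Y unfolding realizations_def by (metis PiE_ext)
  qed
  have "index_code P 1 (length fs) enc dec"
    using len inj by (auto simp: index_code_def dec_def)
  then show ?thesis by blast
qed

text \<open>Quotients by the optimal rate of a problem with a nonempty demand are thus genuine.\<close>

lemma optimal_rate_ge_1:
  assumes wf: "wf_icp P" and u: "u \<in> users P" and f: "f \<in> wants P u"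
  shows "optimal_rate P \<ge> 1"
  unfolding optimal_rate_def
proof (rule cInf_greatest)
  show "{real l / real F | F l. F \<ge> 1 \<and> (\<exists>enc dec. index_code P F l enc dec)} \<noteq> {}"
    using index_code_exists[OF wf] by blast
next
  fix x assume "x \<in> {real l / real F | F l. F \<ge> 1 \<and> (\<exists>enc dec. index_code P F l enc dec)}"
  then obtain F l enc dec where F: "F \<ge> 1" and x: "x = real l / real F"
    and c: "index_code P F l enc dec" by blast
  have ff: "f \<in> files P" "f \<notin> knows P u" using wf u f by (auto simp: wf_icp_def)
  define X where "X = (\<lambda>w. restrict (\<lambda>g. if g = f then w else replicate F False) (files P))"
  define W where "W = {w :: bool list. set w \<subseteq> UNIV \<and> length w = F}"
  have XR: "X w \<in> realizations P F" if "w \<in> W" for w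
    using that by (auto simp: X_def W_def realizations_def)
  have K: "restrict (X w) (knows P u) = restrict (X w') (knows P u)" for w w'
    using ff by (auto simp: X_def restrict_def fun_eq_iff)
  have inj: "inj_on (\<lambda>w. enc (X w)) W"
  proof (rule inj_onI)
    fix w w' assume w: "w \<in> W" "w' \<in> W" and "enc (X w) = enc (X w')"
    then have "X w f = X w' f"
      using c XR u f K[of w w'] unfolding index_code_def by metis
    then show "w = w'" using ff by (simp add: X_def)
  qed
  have fin: "finite {m :: bool list. set m \<subseteq> UNIV \<and> length m = l}"
    by (rule finite_lists_length_eq) simp
  have "card W \<le> card {m :: bool list. set m \<subseteq> UNIV \<and> length m = l}"
    using c XR by (intro card_inj_on_le[OF inj _ fin]) (auto simp: index_code_def)
  then have "(2::nat) ^ F \<le> 2 ^ l"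
    unfolding W_def by (simp only: card_lists_length_eq[OF finite] card_UNIV_bool)
  then have "F \<le> l" by simp
  then show "1 \<le> x" using F by (simp add: x)
qed

end

theory Submission
  imports Defs
begin

text \<open>
  An acyclic set of \<open>n\<close> files, one that can be ordered such that some user wanting a file knows
  only earlier files of the set, forces the rate to be at least \<open>n\<close>. For each type \<open>t\<close>, the first
  gap seen by user \<open>k\<close> is \<open>a\<^bsub>t-1\<^esub>\<close> (indices cyclic), so the files \<open>x\<^bsub>p,t\<^esub>\<close> with
  \<open>1 \<le> p \<le> 1 + a\<^bsub>t-1\<^esub>\<close> for all \<open>t\<close> together form an acyclic set ordered by \<open>p\<close>. It has
  \<open>i + \<Sum>\<^sub>j a\<^sub>j\<close> elements, and \<open>R\<^sub>u \<le> i + 2 \<Sum>\<^sub>j a\<^sub>j\<close>.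
\<close>

lemma acyclic_le_code_length:
  fixes P :: "('u, 'f) icp" and u :: "'f \<Rightarrow> 'u" and r :: "'f \<Rightarrow> nat"
  assumes wf: "wf_icp P" and A: "A \<subseteq> files P"
    and user: "\<And>f. f \<in> A \<Longrightarrow> u f \<in> users P \<and> f \<in> wants P (u f)"
    and acyc: "\<And>f g. f \<in> A \<Longrightarrow> g \<in> A \<Longrightarrow> g \<in> knows P (u f) \<Longrightarrow> r g < r f"
    and c: "index_code P F l enc dec"
  shows "card A * F \<le> l"
proof -
  have finA: "finite A" using wf A finite_subset by (auto simp: wf_icp_def)
  define W where "W = (\<Pi>\<^sub>E f\<in>A. {w :: bool list. set w \<subseteq> UNIV \<and> length w = F})"
  \<comment> \<open>Files outside \<open>A\<close> are frozen to a constant, so only the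
    \<open>card A * F\<close> bits of \<open>w\<close> vary and all side information outside
    \<open>A\<close> is the same for every \<open>w\<close>.\<close>
  define X where "X = (\<lambda>w :: 'f \<Rightarrow> bool list.
    restrict (\<lambda>g. if g \<in> A then w g else replicate F False) (files P))"
  have XR: "X w \<in> realizations P F" if "w \<in> W" for w
    using that by (auto simp: X_def W_def realizations_def)
  have inj: "inj_on (\<lambda>w. enc (X w)) W"
  proof (rule inj_onI)
    fix w w' assume w: "w \<in> W" "w' \<in> W" and eq: "enc (X w) = enc (X w')"
    \<comment> \<open>Successive decoding in order of \<open>r\<close>: once the files of smaller
      rank agree, user \<open>u f\<close> sees the same message and the same side information in
      both realizations, hence decodes the same \<open>f\<close>.\<close>
    have "f \<in> A \<Longrightarrow> X w f = X w' f" for f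
    proof (induction "r f" arbitrary: f rule: less_induct)
      case less
      have "restrict (X w) (knows P (u f)) = restrict (X w') (knows P (u f))"
      proof (rule restrict_ext)
        fix g assume g: "g \<in> knows P (u f)"
        show "X w g = X w' g"
        proof (cases "g \<in> A")
          case True
          then show ?thesis using less acyc g by blast
        qed (simp add: X_def restrict_def)
      qed
      then show ?case
        using c XR w eq user[OF less.prems] unfolding index_code_def by metis
    qed
    moreover have "X v f = v f" if "f \<in> A" for v f using A that by (auto simp: X_def)
    ultimately have "\<forall>f\<in>A. w f = w' f" by metis
    then show "w = w'" by (intro PiE_ext[OF w[unfolded W_def]]) blast
  qed
  have fin: "finite {m :: bool list. set m \<subseteq> UNIV \<and> length m = l}"
    by (rule finite_lists_length_eq) simp
  have "card W \<le> card {m :: bool list. set m \<subseteq> UNIV \<and> length m = l}"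
    using c XR by (intro card_inj_on_le[OF inj _ fin]) (auto simp: index_code_def)
  then have "((2::nat) ^ F) ^ card A \<le> 2 ^ l"
    unfolding W_def card_PiE[OF finA]
    by (simp only: card_lists_length_eq[OF finite] card_UNIV_bool prod_constant)
  then have "(2::nat) ^ (card A * F) \<le> 2 ^ l" by (simp add: power_mult[symmetric] mult.commute)
  then show ?thesis by simp
qed

lemma optimal_rate_ge_acyclic:
  fixes P :: "('u, 'f) icp" and u :: "'f \<Rightarrow> 'u" and r :: "'f \<Rightarrow> nat"
  assumes "wf_icp P" and "A \<subseteq> files P"
    and "\<And>f. f \<in> A \<Longrightarrow> u f \<in> users P \<and> f \<in> wants P (u f)"
    and "\<And>f g. f \<in> A \<Longrightarrow> g \<in> A \<Longrightarrow> g \<in> knows P (u f) \<Longrightarrow> r g < r f"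
  shows "real (card A) \<le> optimal_rate P"
  unfolding optimal_rate_def
proof (rule cInf_greatest)
  show "{real l / real F | F l. F \<ge> 1 \<and> (\<exists>enc dec. index_code P F l enc dec)} \<noteq> {}"
    using index_code_exists[OF assms(1)] by blast
next
  fix x assume "x \<in> {real l / real F | F l. F \<ge> 1 \<and> (\<exists>enc dec. index_code P F l enc dec)}"
  then obtain F l enc dec where F: "F \<ge> 1" and x: "x = real l / real F"
    and c: "index_code P F l enc dec" by blast
  have "card A * F \<le> l"
    using acyclic_le_code_length[where u = u and r = r, OF assms c] by blast
  then have "real (card A) * real F \<le> real l" by (metis of_nat_le_iff of_nat_mult)
  then show "real (card A) \<le> x" using F by (simp add: x pos_le_divide_eq)
qed

text \<open>This cyclic shift matches each type \<open>t\<close> with the index of its first gap. It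
  turns the sum of the first gaps over all types into the plain sum of the
  \<open>a j\<close>.\<close>

lemma bij_betw_cyc_pred:
  assumes "i \<ge> 1"
  shows "bij_betw (\<lambda>t. cyc i (i + t - 1)) {1..i} {1..i}"
proof -
  have "inj_on (\<lambda>t. cyc i (i + t - 1)) {1..i}"
  proof (rule inj_onI)
    fix x y assume x: "x \<in> {1..i}" and y: "y \<in> {1..i}"
      and eq: "cyc i (i + x - 1) = cyc i (i + y - 1)"
    have "(i + x - 1) mod i = (i + y - 1) mod i"
      using cyc_props(2)[OF assms] eq by metis
    moreover have "i + x - 1 = (x - 1) + i" "i + y - 1 = (y - 1) + i" using x y by auto
    ultimately have "(x - 1) mod i = (y - 1) mod i" by simp
    then show "x = y" using x y by auto
  qed
  moreover have "(\<lambda>t. cyc i (i + t - 1)) ` {1..i} \<subseteq> {1..i}"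
    using cyc_props(1)[OF assms] by auto
  ultimately show ?thesis
    by (simp add: bij_betw_def endo_inj_surj)
qed

text \<open>A known file lies a distance \<open>d\<close> ahead of \<open>k\<close> modulo
  \<open>K\<close>, and \<open>d\<close> exceeds the first gap, the term \<open>j = 1\<close> of its
  offset. Since \<open>d < K\<close> and \<open>k \<le> b \<le> K\<close>, nothing wraps around and
  \<open>b = k + d\<close> holds exactly.\<close>

lemma consecutive_icp_knows_distance:
  assumes i: "i \<ge> 1" and k: "k \<in> {1..num_users i L a}"
    and kn: "(b, t) \<in> knows (consecutive_icp i L a) k"
    and le: "k \<le> b" and b: "b \<le> num_users i L a"
  shows "k + a (cyc i (i + t - 1)) < b"
proof -
  define K where "K = num_users i L a"
  have K: "K \<ge> 1" by (simp add: K_def num_users_def)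
  obtain v r where t: "t \<in> {1..i}" and v: "v \<in> {1..i - 1}" and r: "r \<in> {1..L}"
    and beq: "b = cyc K (k + (\<Sum>j=1..v. a (cyc i (i + t - j))) + (v - 1) * L + r)"
    using kn by (auto simp: consecutive_icp_def Let_def K_def)
  define d where "d = (\<Sum>j=1..v. a (cyc i (i + t - j))) + (v - 1) * L + r"
  \<comment> \<open>At most \<open>i - 1\<close> blocks of length \<open>L\<close> and distinct gaps
    make up \<open>d\<close>; the summand 1 in \<open>num_users\<close> makes the bound
    strict.\<close>
  have "(v - 1) * L + r \<le> (v - 1) * L + L" using r by auto
  also have "\<dots> = v * L" using v by (cases v) auto
  also have "\<dots> \<le> (i - 1) * L" using v by (intro mult_right_mono) auto
  finally have dK: "d < K"
    using cyc_offset_sum[OF t v, of a] by (auto simp: d_def K_def num_users_def)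
  have "a (cyc i (i + t - 1)) \<le> (\<Sum>j=1..v. a (cyc i (i + t - j)))"
    using v by (intro member_le_sum[where f = "\<lambda>j. a (cyc i (i + t - j))"]) auto
  then have d: "a (cyc i (i + t - 1)) < d" using r by (auto simp: d_def)
  have "b mod K = (k + d) mod K"
    using cyc_props(2)[OF K, of "k + d"] beq by (simp add: d_def add.assoc)
  then have "int (b mod K) = int ((k + d) mod K)" by simp
  then have "int K dvd int b - int (k + d)" by (simp only: zmod_int mod_eq_dvd_iff)
  \<comment> \<open>Both \<open>b - k\<close> and \<open>d\<close> lie between 0 and
    \<open>K - 1\<close>, so their difference is a multiple of \<open>K\<close> only if it
    vanishes.\<close>
  moreover have "\<bar>int b - int (k + d)\<bar> < int K" using dK k b le by (auto simp: K_def)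
  ultimately have "int b - int (k + d) = 0" 
    using dvd_imp_le_int[of "int b - int (k + d)" "int K"] by linarith
  then show ?thesis using d by linarith
qed

lemma optimal_rate_consecutive_icp_ge:
  assumes i: "i \<ge> 1"
  shows "real ((\<Sum>j=1..i. a j) + i) \<le> optimal_rate (consecutive_icp i L a)"
proof -
  define c where "c = (\<lambda>t. a (cyc i (i + t - 1)))"
  \<comment> \<open>For each type, the file at position 1 together with the whole first gap after
    it, which user 1 does not know. By \<open>cK\<close> below these positions stay within the
    \<open>K\<close> users.\<close>
  define A where "A = (\<lambda>(t, p). (p, t)) ` (SIGMA t:{1..i}. {1..1 + c t})"
  have cS: "c t \<le> (\<Sum>j=1..i. a j)" for t
    unfolding c_def using cyc_props(1)[OF i] by (intro member_le_sum) auto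
  have cK: "1 + c t \<le> num_users i L a" for t
    using cS[of t] by (simp add: num_users_def)
  have "card A = (\<Sum>t=1..i. 1 + c t)"
    unfolding A_def by (subst card_image) (auto simp: inj_on_def)
  also have "\<dots> = i + (\<Sum>t=1..i. c t)" unfolding sum.distrib by simp
  also have "(\<Sum>t=1..i. c t) = (\<Sum>j=1..i. a j)"
    unfolding c_def by (rule sum.reindex_bij_betw[OF bij_betw_cyc_pred[OF i]])
  finally have card: "card A = (\<Sum>j=1..i. a j) + i" by simp
  have A: "p \<in> {1..num_users i L a} \<and> p \<le> 1 + c t \<and> t \<in> {1..i}" if "(p, t) \<in> A" for p t
    using that cK[of t] by (auto simp: A_def)
  have "real (card A) \<le> optimal_rate (consecutive_icp i L a)"
  proof (rule optimal_rate_ge_acyclic[where u = fst and r = fst])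
    show "A \<subseteq> files (consecutive_icp i L a)"
      using A by (auto simp: consecutive_icp_def Let_def)
    show "fst f \<in> users (consecutive_icp i L a) \<and> f \<in> wants (consecutive_icp i L a) (fst f)"
      if "f \<in> A" for f
      using that A by (cases f) (auto simp: consecutive_icp_def Let_def)
    show "fst g < fst f"
      if f: "f \<in> A" and g: "g \<in> A" and kn: "g \<in> knows (consecutive_icp i L a) (fst f)" for f g
    proof (rule ccontr)
      assume ge: "\<not> fst g < fst f"
      obtain k s b t where eqs: "f = (k, s)" "g = (b, t)" by fastforce
      \<comment> \<open>The gap is that of the type \<open>t\<close> of the known file. As
        \<open>k \<ge> 1\<close>, the file would lie beyond position \<open>1 + c t\<close>, outside
        \<open>A\<close>.\<close>
      have "k + c t < b"
        unfolding c_def using A[of k s] A[of b t] f g kn ge eqs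
        by (intro consecutive_icp_knows_distance[OF i, where L = L]) simp_all
      then show False using A[of k s] A[of b t] f g eqs by simp
    qed
  qed (rule wf_consecutive_icp)
  then show ?thesis by (simp add: card)
qed

theorem corollary3:
  fixes i L K :: nat and a :: "nat \<Rightarrow> nat" and R_u :: real
  assumes "i \<ge> 1" and "L \<ge> 1"
    and "\<forall>j\<in>{1..i}. a j \<le> a i"
    and "K = 1 + (i - 1) * L + (\<Sum>j=1..i. a j)"
    and "R_u = min (2 * (real K - (real i - 1) * real L) + real i - 2 - real (a i)) (real K)"
  shows "R_u / optimal_rate (consecutive_icp i L a) \<le> 2"
proof -
  have K: "real K - (real i - 1) * real L = 1 + real (\<Sum>j=1..i. a j)"
    using assms(1,4) by (simp add: of_nat_diff)
  have R: "real ((\<Sum>j=1..i. a j) + i) \<le> optimal_rate (consecutive_icp i L a)"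
    by (rule optimal_rate_consecutive_icp_ge[OF assms(1)])
  have "R_u \<le> 2 * (1 + real (\<Sum>j=1..i. a j)) + real i - 2 - real (a i)"
    using assms(5) unfolding K by linarith
  \<comment> \<open>With \<open>S\<close> the sum of the \<open>a j\<close>, the left side is
    \<open>2 * S + i - a i\<close>. The sum is kept as one atom for the arithmetic.\<close>
  also have "\<dots> \<le> 2 * real ((\<Sum>j=1..i. a j) + i)" by (simp del: of_nat_sum)
  also have "\<dots> \<le> 2 * optimal_rate (consecutive_icp i L a)"
    using R by (intro mult_left_mono) simp_all
  finally have "R_u \<le> 2 * optimal_rate (consecutive_icp i L a)" .
  moreover have "optimal_rate (consecutive_icp i L a) > 0"
    by (rule less_le_trans[OF _ R]) (use assms(1) in \<open>simp del: of_nat_sum\<close>)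
  ultimately show ?thesis by (simp add: pos_divide_le_eq)
qed

end
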